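(* Let $n\geq 1$ be an integer, $p$ a prime, $q$ a power of $p$, and let $R$ be a commutative ring in which $p$ is invertible. Let $G_n=\mathbf{SL}_n(\mathbb{F}_q)$, let $U_n$ be the subgroup of $n\times n$ upper unitriangular matrices over $\mathbb{F}_q$, let $\mathrm{D}(U_n)$ be its derived subgroup, and set $$e_n=\frac{1}{|\mathrm{D}(U_n)|}\sum_{u\in \mathrm{D}(U_n)} u \in RG_n.$$ Then $e_n$ is a full idempotent of $RG_n$, i.e. $RG_n\, e_n\, RG_n = RG_n$. *)

theory Defs
  imports "Jordan_Normal_Form.Determinant" "HOL-Algebra.Generated_Groups"
begin

definition SL_mats :: "nat \<Rightarrow> 'k::comm_ring_1 mat set" where
  "SL_mats n = {A \<in> carrier_mat n n. det A = 1}"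

definition unitri_mats :: "nat \<Rightarrow> 'k::comm_ring_1 mat set" where
  "unitri_mats n = {A \<in> carrier_mat n n.
      (\<forall>i<n. A $$ (i,i) = 1) \<and> (\<forall>i<n. \<forall>j<i. A $$ (i,j) = 0)}"

definition mat_grp :: "nat \<Rightarrow> 'k::comm_ring_1 mat set \<Rightarrow> 'k mat monoid" where
  "mat_grp n S = \<lparr>carrier = S, mult = (\<lambda>A B. A * B), one = 1\<^sub>m n\<rparr>"

definition DU :: "nat \<Rightarrow> 'k::comm_ring_1 mat set" where
  "DU n = derived (mat_grp n (unitri_mats n)) (unitri_mats n)"

text \<open>Group algebra R G of a finite group G: functions G \<rightarrow> R (zero outside the carrier),
  with convolution product.\<close>
definition galg_carrier :: "('a, 'b) monoid_scheme \<Rightarrow> ('a \<Rightarrow> 'r::comm_ring_1) set" where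
  "galg_carrier G = {a. \<forall>g. g \<notin> carrier G \<longrightarrow> a g = 0}"

definition galg_mult :: "('a, 'b) monoid_scheme \<Rightarrow> ('a \<Rightarrow> 'r::comm_ring_1) \<Rightarrow> ('a \<Rightarrow> 'r) \<Rightarrow> ('a \<Rightarrow> 'r)" where
  "galg_mult G a b = (\<lambda>g. if g \<in> carrier G
      then (\<Sum>h\<in>carrier G. a h * b (inv\<^bsub>G\<^esub> h \<otimes>\<^bsub>G\<^esub> g)) else 0)"

definition galg_two_sided :: "('a, 'b) monoid_scheme \<Rightarrow> ('a \<Rightarrow> 'r::comm_ring_1) \<Rightarrow> ('a \<Rightarrow> 'r) set" where
  "galg_two_sided G e = {x. \<exists>(k::nat) a b. (\<forall>i<k. a i \<in> galg_carrier G \<and> b i \<in> galg_carrier G) \<and>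
      x = (\<lambda>g. \<Sum>i<k. galg_mult G (galg_mult G (a i) e) (b i) g)}"

definition e_idem :: "nat \<Rightarrow> 'k::comm_ring_1 mat \<Rightarrow> 'r::comm_ring_1" where
  "e_idem n = (\<lambda>g. if g \<in> (DU n :: 'k mat set)
      then (THE y::'r. of_nat (card (DU n :: 'k mat set)) * y = 1) else 0)"

end

theory Submission
  imports Defs
begin

text \<open>
  Write \<open>1\<^sub>H\<close> for the indicator function of \<open>H\<close>. The two-sided ideal generated by \<open>e\<close> contains every
  linear combination of two-sided translates of \<open>e\<close>, so it suffices to reach \<open>1\<^sub>H\<close> for trivial \<open>H\<close>.
  The derived subgroup of \<open>U\<^sub>n\<close> lies in the group of unitriangular matrices with zero superdiagonal,
  whose indicator is therefore a sum of translates of \<open>e\<close> up to a unit. From there one strips off one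
  root subgroup at a time, row by row upwards in each column and column by column from the left. If
  \<open>H\<close> is what remains after removing position \<open>(a,b)\<close> with \<open>a + 2 \<le> b\<close>, let \<open>P\<close> be \<open>H\<close> with both positions
  \<open>(a,b)\<close> and \<open>(a+1,b)\<close> added. Then \<open>P/H\<close> is a plane over the field of \<open>q\<close> elements, and counting
  points on its \<open>q + 1\<close> lines through the origin gives
  \<open>q 1\<^sub>H = (\<Sum>L. 1\<^sub>L) - 1\<^sub>P\<close>, where \<open>L\<close> runs over the preimages of the lines. These preimages are all
  conjugate under the \<open>SL\<^sub>2\<close> acting on the coordinates \<open>a, a + 1\<close>, which normalises \<open>H\<close>.
\<close>

subsection \<open>Translates in the group algebra\<close>

text \<open>For \<open>e\<close> in the group algebra this is the ideal it generates, described
  without convolution: as a function of x, f(g x h) is the product of f with the inverse of g on the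
  left and the inverse of h on the right. The cut-off at the carrier keeps translates inside
  \<open>galg_carrier G\<close>.\<close>

inductive_set bispan :: "('a, 'b) monoid_scheme \<Rightarrow> ('a \<Rightarrow> 'r::comm_ring_1) \<Rightarrow> ('a \<Rightarrow> 'r) set"
  for G (structure) and e where
  base: "e \<in> bispan G e"
| add: "f \<in> bispan G e \<Longrightarrow> f' \<in> bispan G e \<Longrightarrow> (\<lambda>x. f x + f' x) \<in> bispan G e"
| scale: "f \<in> bispan G e \<Longrightarrow> (\<lambda>x. c * f x) \<in> bispan G e"
| translate: "f \<in> bispan G e \<Longrightarrow> g \<in> carrier G \<Longrightarrow> h \<in> carrier G \<Longrightarrow>
    (\<lambda>x. if x \<in> carrier G then f (g \<otimes> x \<otimes> h) else 0) \<in> bispan G e"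

lemma bispan_trans: "f \<in> bispan G d \<Longrightarrow> d \<in> bispan G e \<Longrightarrow> f \<in> bispan G e"
  by (induction rule: bispan.induct) (auto intro: bispan.intros)

lemma bispan_sum:
  assumes "finite A" "\<And>a. a \<in> A \<Longrightarrow> f a \<in> bispan G e"
  shows "(\<lambda>x. \<Sum>a\<in>A. f a x) \<in> bispan G e"
  using assms
proof (induction A rule: finite_induct)
  case empty
  show ?case using bispan.scale[OF bispan.base, of 0 e G] by simp
next
  case (insert a A)
  then show ?case using bispan.add[of "f a" G e "\<lambda>x. \<Sum>a\<in>A. f a x"] by simp
qed

context group
begin

lemma galg_mult_translate_left:
  assumes g: "g \<in> carrier G" and x: "x \<in> carrier G"
  shows "galg_mult G a e (g \<otimes> x)
    = galg_mult G (\<lambda>y. if y \<in> carrier G then a (g \<otimes> y) else 0) e x"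
proof -
  have "(\<Sum>h\<in>carrier G. a h * e (inv h \<otimes> (g \<otimes> x)))
      = (\<Sum>h\<in>carrier G. a (g \<otimes> h) * e (inv h \<otimes> x))"
  proof (rule sum.reindex_bij_witness[of _ "\<lambda>h. g \<otimes> h" "\<lambda>h. inv g \<otimes> h"])
    fix h assume h: "h \<in> carrier G"
    show "a (g \<otimes> (inv g \<otimes> h)) * e (inv (inv g \<otimes> h) \<otimes> x) = a h * e (inv h \<otimes> (g \<otimes> x))"
      using g h x by (simp add: inv_mult_group inv_solve_left m_assoc flip: m_assoc)
  qed (use g in \<open>auto simp flip: m_assoc\<close>)
  then show ?thesis using g x by (simp add: galg_mult_def cong: sum.cong)
qed

lemma galg_mult_translate_right:
  assumes h: "h \<in> carrier G" and x: "x \<in> carrier G"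
  shows "galg_mult G f b (x \<otimes> h)
    = galg_mult G f (\<lambda>y. if y \<in> carrier G then b (y \<otimes> h) else 0) x"
  using h x by (simp add: galg_mult_def m_assoc cong: sum.cong)

text \<open>Rule induction on the span: sums concatenate two families of coefficients, scalars go
  into the left coefficients, and a translation by g and h is absorbed by the left and right
  coefficients respectively.\<close>

lemma bispan_subset_two_sided:
  assumes fin: "finite (carrier G)" and e: "e \<in> galg_carrier G"
  shows "bispan G e \<subseteq> galg_two_sided G e"
proof
  fix f assume "f \<in> bispan G e"
  then show "f \<in> galg_two_sided G e"
  proof induction
    case base
    \<comment> \<open>The unit of the group algebra, so that \<open>e\<close> is the one-term sum d
      e d.\<close>
    define d where "d x = (if x = \<one> then 1 else 0 :: 'c)" for x
    have "galg_mult G d e x = e x" for x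
    proof (cases "x \<in> carrier G")
      case True
      have "(\<Sum>h\<in>carrier G. d h * e (inv h \<otimes> x))
          = (\<Sum>h\<in>carrier G. if h = \<one> then e (inv h \<otimes> x) else 0)"
        by (rule sum.cong) (auto simp: d_def)
      also have "\<dots> = e x" using True fin by simp
      finally show ?thesis using True by (simp add: galg_mult_def)
    qed (use e in \<open>simp add: galg_mult_def galg_carrier_def\<close>)
    moreover have "galg_mult G e d x = e x" for x
    proof (cases "x \<in> carrier G")
      case True
      have "(\<Sum>h\<in>carrier G. e h * d (inv h \<otimes> x))
          = (\<Sum>h\<in>carrier G. if h = x then e h else 0)"
        using True inv_solve_left' by (intro sum.cong) (auto simp: d_def)
      also have "\<dots> = e x" using True fin by simp
      finally show ?thesis using True by (simp add: galg_mult_def)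
    qed (use e in \<open>simp add: galg_mult_def galg_carrier_def\<close>)
    ultimately have "galg_mult G (galg_mult G d e) d = e" by presburger
    moreover have "d \<in> galg_carrier G" by (auto simp: d_def galg_carrier_def)
    ultimately show ?case
      unfolding galg_two_sided_def
      by (auto intro!: exI[of _ "1::nat"] exI[of _ "\<lambda>_. d"])
  next
    case (add f f')
    obtain k :: nat and a b where ab: "\<forall>i<k. a i \<in> galg_carrier G \<and> b i \<in> galg_carrier G"
      "f = (\<lambda>g. \<Sum>i<k. galg_mult G (galg_mult G (a i) e) (b i) g)"
      using add.IH(1) unfolding galg_two_sided_def by blast
    obtain k' :: nat and a' b' where ab': "\<forall>i<k'. a' i \<in> galg_carrier G \<and> b' i \<in> galg_carrier G"
      "f' = (\<lambda>g. \<Sum>i<k'. galg_mult G (galg_mult G (a' i) e) (b' i) g)"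
      using add.IH(2) unfolding galg_two_sided_def by blast
    have split: "(\<Sum>i<k + k'. F i) = (\<Sum>i<k. F i) + (\<Sum>i<k'. F (k + i))" for F :: "nat \<Rightarrow> 'c"
      by (induction k') (simp_all add: add.assoc)
    show ?case
      unfolding galg_two_sided_def mem_Collect_eq
      by (rule exI[of _ "k + k'"], rule exI[of _ "\<lambda>i. if i < k then a i else a' (i - k)"],
          rule exI[of _ "\<lambda>i. if i < k then b i else b' (i - k)"]) (use ab ab' in \<open>auto simp: split\<close>)
  next
    case (scale f c)
    obtain k :: nat and a b where ab: "\<forall>i<k. a i \<in> galg_carrier G \<and> b i \<in> galg_carrier G"
      "f = (\<lambda>g. \<Sum>i<k. galg_mult G (galg_mult G (a i) e) (b i) g)"
      using scale.IH unfolding galg_two_sided_def by blast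
    have "galg_mult G (\<lambda>x. c * f x) b = (\<lambda>g. c * galg_mult G f b g)" for f b :: "'a \<Rightarrow> 'c"
      by (simp add: galg_mult_def sum_distrib_left mult.assoc fun_eq_iff)
    with ab have "(\<lambda>x. c * f x) = (\<lambda>g. \<Sum>i<k. galg_mult G (galg_mult G (\<lambda>x. c * a i x) e) (b i) g)"
      by (simp add: sum_distrib_left)
    moreover have "\<forall>i<k. (\<lambda>x. c * a i x) \<in> galg_carrier G \<and> b i \<in> galg_carrier G"
      using ab(1) by (simp add: galg_carrier_def)
    ultimately show ?case
      unfolding galg_two_sided_def mem_Collect_eq
      by (intro exI[of _ k] exI[of _ "\<lambda>i x. c * a i x"] exI[of _ b] conjI)
  next
    case (translate f g h)
    obtain k :: nat and a b where ab: "\<forall>i<k. a i \<in> galg_carrier G \<and> b i \<in> galg_carrier G"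
      "f = (\<lambda>g. \<Sum>i<k. galg_mult G (galg_mult G (a i) e) (b i) g)"
      using translate.IH unfolding galg_two_sided_def by blast
    define a' where "a' i = (\<lambda>y. if y \<in> carrier G then a i (g \<otimes> y) else 0)" for i
    define b' where "b' i = (\<lambda>y. if y \<in> carrier G then b i (y \<otimes> h) else 0)" for i
    have eq: "(if x \<in> carrier G then galg_mult G (galg_mult G (a i) e) (b i) (g \<otimes> x \<otimes> h) else 0)
        = galg_mult G (galg_mult G (a' i) e) (b' i) x" for i x
    proof (cases "x \<in> carrier G")
      case True
      have "galg_mult G (galg_mult G (a i) e) (b i) (g \<otimes> x \<otimes> h)
          = galg_mult G (galg_mult G (a i) e) (b' i) (g \<otimes> x)"
        using True translate.hyps by (simp add: galg_mult_translate_right b'_def)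
      also have "\<dots> = galg_mult G (\<lambda>y. if y \<in> carrier G then galg_mult G (a i) e (g \<otimes> y) else 0) (b' i) x"
        using True translate.hyps by (simp add: galg_mult_translate_left)
      also have "(\<lambda>y. if y \<in> carrier G then galg_mult G (a i) e (g \<otimes> y) else 0) = galg_mult G (a' i) e"
      proof
        fix y
        show "(if y \<in> carrier G then galg_mult G (a i) e (g \<otimes> y) else 0) = galg_mult G (a' i) e y"
          unfolding a'_def using translate.hyps galg_mult_translate_left[of g y "a i" e]
          by (cases "y \<in> carrier G") (simp_all add: galg_mult_def)
      qed
      finally show ?thesis using True by simp
    qed (simp add: galg_mult_def)
    have "(\<lambda>x. if x \<in> carrier G then f (g \<otimes> x \<otimes> h) else 0)
        = (\<lambda>x. \<Sum>i<k. galg_mult G (galg_mult G (a' i) e) (b' i) x)"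
      unfolding ab(2) by (simp add: fun_eq_iff flip: eq)
    moreover have "\<forall>i<k. a' i \<in> galg_carrier G \<and> b' i \<in> galg_carrier G"
      by (simp add: galg_carrier_def a'_def b'_def)
    ultimately show ?case
      unfolding galg_two_sided_def mem_Collect_eq
      by (intro exI[of _ k] exI[of _ a'] exI[of _ b'] conjI)
  qed
qed

text \<open>Translates of the point mass at the identity are all the point masses, and these span
  the group algebra.\<close>

lemma two_sided_eq_carrier:
  assumes fin: "finite (carrier G)" and e: "e \<in> galg_carrier G"
    and one: "(\<lambda>x. of_bool (x \<in> {\<one>})) \<in> bispan G e"
  shows "galg_two_sided G e = galg_carrier G"
proof
  show "galg_two_sided G e \<subseteq> galg_carrier G"
    by (auto simp: galg_two_sided_def galg_carrier_def galg_mult_def)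
  show "galg_carrier G \<subseteq> galg_two_sided G e"
  proof
    fix f :: "'a \<Rightarrow> 'c" assume f: "f \<in> galg_carrier G"
    \<comment> \<open>\<open>?d g\<close> is the point mass at g, written as a translate so that
      \<open>bispan.translate\<close> applies literally.\<close>
    let ?d = "\<lambda>g x. if x \<in> carrier G then of_bool (inv g \<otimes> x \<otimes> \<one> \<in> {\<one>}) else 0 :: 'c"
    have "(\<lambda>x. \<Sum>g\<in>carrier G. f g * ?d g x) \<in> bispan G e"
      using one by (intro bispan_sum fin bispan.scale bispan.translate) auto
    also have "(\<lambda>x. \<Sum>g\<in>carrier G. f g * ?d g x) = f"
    proof
      fix x
      show "(\<Sum>g\<in>carrier G. f g * ?d g x) = f x"
      proof (cases "x \<in> carrier G")
        case True
        have "(\<Sum>g\<in>carrier G. f g * ?d g x) = (\<Sum>g\<in>carrier G. if g = x then f g else 0)"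
          using True inv_solve_left' by (intro sum.cong) auto
        then show ?thesis using True fin by simp
      qed (use f in \<open>simp add: galg_carrier_def\<close>)
    qed
    finally show "f \<in> galg_two_sided G e"
      using bispan_subset_two_sided[OF fin e] by blast
  qed
qed

section \<open>Subgroups and their indicator functions\<close>

lemma subgroup_of_finite_closed:
  assumes "finite H" "H \<subseteq> carrier G" "\<one> \<in> H" "\<And>x y. x \<in> H \<Longrightarrow> y \<in> H \<Longrightarrow> x \<otimes> y \<in> H"
  shows "subgroup H G"
proof (rule subgroupI)
  fix x assume x: "x \<in> H"
  \<comment> \<open>Left multiplication by x is an injective self-map of a finite set, hence onto,
    so it reaches the identity.\<close>
  have "inj_on ((\<otimes>) x) H"
    using x assms(2) by (intro inj_onI) (metis Units_eq Units_l_cancel subsetD)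
  then have "(\<otimes>) x ` H = H" using x assms(1,4) by (intro endo_inj_surj) auto
  then obtain y where "y \<in> H" "x \<otimes> y = \<one>" using assms(3) by (metis imageE)
  then show "inv x \<in> H" using x assms(2) by (metis inv_equality inv_inv subsetD inv_closed)
qed (use assms in auto)

text \<open>Sum the translates of the indicator of H by all k in K. A point x of K is counted once
  for each k with k x in H, that is \<open>card H\<close> times; a point outside K is never counted.
  Dividing by \<open>card H\<close> leaves the indicator of K.\<close>

lemma supergroup_in_bispan:
  fixes y :: "'r::comm_ring_1"
  assumes K: "subgroup K G" "finite K" and H: "H \<subseteq> K" and y: "of_nat (card H) * y = 1"
  shows "(\<lambda>x. of_bool (x \<in> K) :: 'r) \<in> bispan G (\<lambda>x. of_bool (x \<in> H))"
proof -
  interpret K: subgroup K G by (fact K)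
  let ?f = "\<lambda>k x. if x \<in> carrier G then of_bool (k \<otimes> x \<otimes> \<one> \<in> H) else 0 :: 'r"
  have "(\<lambda>x. y * (\<Sum>k\<in>K. ?f k x)) \<in> bispan G (\<lambda>x. of_bool (x \<in> H))"
    by (intro bispan_sum K bispan.scale bispan.translate bispan.base) auto
  also have "(\<lambda>x. y * (\<Sum>k\<in>K. ?f k x)) = (\<lambda>x. of_bool (x \<in> K))"
  proof
    fix x
    show "y * (\<Sum>k\<in>K. ?f k x) = of_bool (x \<in> K)"
    proof (cases "x \<in> K")
      case True
      have "(\<Sum>k\<in>K. ?f k x) = (\<Sum>k\<in>K. of_bool (k \<in> H))"
        using True H
        by (intro sum.reindex_bij_witness[of _ "\<lambda>k. k \<otimes> inv x" "\<lambda>k. k \<otimes> x"]) (auto simp: m_assoc)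
      also have "\<dots> = of_nat (card H)"
        using H K(2) by (simp add: of_bool_def sum.If_cases Int_absorb1)
      finally show ?thesis using True y by (simp add: mult.commute)
    next
      case False
      have "?f k x = 0" if "k \<in> K" for k
      proof (cases "x \<in> carrier G")
        case True
        have "k \<otimes> x \<notin> K"
        proof
          assume "k \<otimes> x \<in> K"
          then have "inv k \<otimes> (k \<otimes> x) \<in> K" using that by blast
          with True that False show False by (simp flip: m_assoc)
        qed
        then show ?thesis using True that H by auto
      qed simp
      with False show ?thesis by simp
    qed
  qed
  finally show ?thesis .
qed

text \<open>\<open>e\<close> is invariant under left translation by H, so each of the
  \<open>card H\<close> nonzero summands of the convolution is y times the value of
  \<open>e\<close>.\<close>

lemma idempotent_subgroup:
  fixes y :: "'r::comm_ring_1"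
  assumes fin: "finite (carrier G)" and H: "subgroup H G" and y: "of_nat (card H) * y = 1"
  defines "e \<equiv> \<lambda>g. if g \<in> H then y else 0"
  shows "galg_mult G e e = e"
proof
  fix g
  interpret H: subgroup H G by (fact H)
  have finH: "finite H" using fin H.subset finite_subset by blast
  show "galg_mult G e e g = e g"
  proof (cases "g \<in> carrier G")
    case g: True
    have "(\<Sum>h\<in>carrier G. e h * e (inv h \<otimes> g)) = (\<Sum>h\<in>H. e h * e (inv h \<otimes> g))"
      using fin by (intro sum.mono_neutral_right) (auto simp: e_def)
    also have "\<dots> = (\<Sum>h\<in>H. y * e g)"
    proof (rule sum.cong)
      fix h assume h: "h \<in> H"
      have "inv h \<otimes> g \<in> H \<longleftrightarrow> g \<in> H"
      proof
        assume "inv h \<otimes> g \<in> H"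
        then have "h \<otimes> (inv h \<otimes> g) \<in> H" using h by blast
        then show "g \<in> H" using h g by (simp flip: m_assoc)
      qed (use h in auto)
      then show "e h * e (inv h \<otimes> g) = y * e g" using h by (simp add: e_def)
    qed simp
    also have "\<dots> = e g" using y by (simp flip: mult.assoc)
    finally show ?thesis using g by (simp add: galg_mult_def)
  qed (auto simp: galg_mult_def e_def)
qed

end

subsection \<open>Unitriangular pattern groups\<close>

text \<open>\<open>T\<close> lists the off-diagonal positions left free, so removing a root subgroup
  means removing a pair. The set is a group when \<open>T\<close> is transitive and strictly upper
  triangular.\<close>

definition pat_mats :: "nat \<Rightarrow> (nat \<times> nat) set \<Rightarrow> 'k::comm_ring_1 mat set" where
  "pat_mats n T = {A \<in> carrier_mat n n. (\<forall>i<n. A $$ (i,i) = 1) \<and>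
     (\<forall>i<n. \<forall>j<n. i \<noteq> j \<longrightarrow> (i,j) \<notin> T \<longrightarrow> A $$ (i,j) = 0)}"

text \<open>Indices start at 0. Columns left of b are already cleared, column b keeps only its rows
  above a, and columns right of b are full above the superdiagonal. In particular
  \<open>stair 0 0\<close> is everything strictly above the superdiagonal.\<close>

definition stair :: "nat \<Rightarrow> nat \<Rightarrow> (nat \<times> nat) set" where
  "stair b a = {(i,j). b < j \<and> i + 2 \<le> j \<or> j = b \<and> i < a}"

lemma finite_carrier_mat: "finite (carrier_mat n m :: 'k::finite mat set)"
proof -
  have "carrier_mat n m \<subseteq> mat n m ` (PiE ({..<n} \<times> {..<m}) (\<lambda>_. UNIV :: 'k set))"
  proof
    fix A :: "'k mat" assume "A \<in> carrier_mat n m"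
    then have "A = mat n m (restrict (\<lambda>ij. A $$ ij) ({..<n} \<times> {..<m}))" by auto
    then show "A \<in> mat n m ` (PiE ({..<n} \<times> {..<m}) (\<lambda>_. UNIV))"
      by (rule image_eqI[where f = "mat n m"]) auto
  qed
  then show ?thesis by (rule finite_subset) (auto intro!: finite_PiE)
qed

lemma one_mat_pat_mats: "1\<^sub>m n \<in> pat_mats n T"
  by (auto simp: pat_mats_def)

lemma pat_mats_empty: "pat_mats n {} = {1\<^sub>m n}"
  by (auto simp: pat_mats_def intro!: eq_matI)

lemma pat_mats_cong:
  "(\<And>i j. i < n \<Longrightarrow> j < n \<Longrightarrow> i \<noteq> j \<Longrightarrow> (i,j) \<in> S \<longleftrightarrow> (i,j) \<in> T) \<Longrightarrow> pat_mats n S = pat_mats n T"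
  unfolding pat_mats_def by blast

lemma pat_mats_mono: "S \<subseteq> T \<Longrightarrow> pat_mats n S \<subseteq> pat_mats n T"
  unfolding pat_mats_def by blast

lemma mult_mat_entry:
  "A \<in> carrier_mat n n \<Longrightarrow> B \<in> carrier_mat n n \<Longrightarrow> i < n \<Longrightarrow> j < n \<Longrightarrow>
    (A * B) $$ (i,j) = (\<Sum>k<n. A $$ (i,k) * B $$ (k,j))"
  by (auto simp: scalar_prod_def atLeast0LessThan)

text \<open>A nonzero term of an entry (i,j) of the product passes through some k with each of its
  two steps trivial or in \<open>T\<close>. Transitivity puts (i,j) in \<open>T\<close> when i and j
  differ, and strict triangularity leaves only k = i on the diagonal.\<close>

lemma pat_mats_mult:
  assumes T: "trans T" "\<And>i j. (i,j) \<in> T \<Longrightarrow> i < j"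
    and A: "A \<in> pat_mats n T" and B: "B \<in> pat_mats n T"
  shows "A * B \<in> pat_mats n T"
proof -
  have Ac: "A \<in> carrier_mat n n" and Bc: "B \<in> carrier_mat n n"
    using A B by (auto simp: pat_mats_def)
  have a: "k = i \<or> (i,k) \<in> T" if "A $$ (i,k) \<noteq> 0" "i < n" "k < n" for i k
    using A that by (auto simp: pat_mats_def split: if_splits)
  have b: "k = j \<or> (k,j) \<in> T" if "B $$ (k,j) \<noteq> 0" "j < n" "k < n" for j k
    using B that by (auto simp: pat_mats_def split: if_splits)
  have "(\<Sum>k<n. A $$ (i,k) * B $$ (k,i)) = 1" if i: "i < n" for i
  proof -
    have "A $$ (i,k) * B $$ (k,i) = (if k = i then 1 else 0)" if "k < n" for k
    proof (cases "k = i")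
      case True
      then show ?thesis using A B i by (simp add: pat_mats_def)
    next
      case False
      then show ?thesis using a[of i k] b[of k i] T(2)[of i k] T(2)[of k i] i that by fastforce
    qed
    then show ?thesis using i by simp
  qed
  moreover have "(\<Sum>k<n. A $$ (i,k) * B $$ (k,j)) = 0"
    if "i < n" "j < n" "i \<noteq> j" "(i,j) \<notin> T" for i j
  proof (rule sum.neutral, safe)
    fix k assume "k < n"
    then show "A $$ (i,k) * B $$ (k,j) = 0"
      using a[of i k] b[of k j] that T(1) by (metis mult_not_zero transD)
  qed
  ultimately show ?thesis
    using Ac Bc by (simp add: pat_mats_def mult_mat_entry del: index_mult_mat(1))
qed

text \<open>The entries at positions of \<open>T\<close> inside the matrix are free and independent.
  The order is thus a power of q, which makes it a unit wherever q is one.\<close>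

lemma card_pat_mats:
  assumes "\<And>i j. (i,j) \<in> T \<Longrightarrow> i < j"
  shows "\<exists>N. card (pat_mats n T :: 'k::{comm_ring_1,finite} mat set) = card (UNIV :: 'k set) ^ N"
proof -
  let ?T = "T \<inter> {..<n} \<times> {..<n}"
  let ?M = "\<lambda>f. mat n n (\<lambda>(i,j). if i = j then 1 else if (i,j) \<in> T then f (i,j) else (0::'k))"
  have irr: "(i,i) \<notin> T" for i using assms by blast
  have "bij_betw (\<lambda>A. restrict (\<lambda>ij. A $$ ij) ?T) (pat_mats n T) (PiE ?T (\<lambda>_. UNIV :: 'k set))"
  proof (rule bij_betw_byWitness[where f' = ?M])
    show "\<forall>A\<in>pat_mats n T. ?M (restrict (\<lambda>ij. A $$ ij) ?T) = A"
      by (auto simp: pat_mats_def intro!: eq_matI split: if_splits)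
    show "\<forall>f\<in>PiE ?T (\<lambda>_. UNIV). restrict (\<lambda>ij. ?M f $$ ij) ?T = f"
      using irr by (auto simp: fun_eq_iff restrict_def PiE_def extensional_def)
    show "?M ` (PiE ?T (\<lambda>_. UNIV)) \<subseteq> pat_mats n T"
      by (auto simp: pat_mats_def)
  qed (auto split: if_splits)
  then have "card (pat_mats n T :: 'k mat set) = card (PiE ?T (\<lambda>_. UNIV :: 'k set))"
    by (rule bij_betw_same_card)
  also have "\<dots> = card (UNIV :: 'k set) ^ card ?T" by (simp add: card_PiE)
  finally show ?thesis by blast
qed

lemma pat_mats_subset_SL:
  assumes "\<And>i j. (i,j) \<in> T \<Longrightarrow> i < j"
  shows "pat_mats n T \<subseteq> SL_mats n"
proof
  fix A :: "'a mat" assume A: "A \<in> pat_mats n T"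
  then have c: "A \<in> carrier_mat n n" by (simp add: pat_mats_def)
  have "A $$ (i,j) = 0" if "j < i" "i < n" for i j
  proof -
    have "(i,j) \<notin> T" "j < n" "i \<noteq> j" using assms[of i j] that by auto
    then show ?thesis using A that by (simp add: pat_mats_def)
  qed
  then have "upper_triangular A" using c by (intro upper_triangularI) auto
  then have "det A = prod_list (diag_mat A)" using c by (rule det_upper_triangular)
  also have "\<dots> = 1"
    using A c by (auto simp: prod_list_diag_prod pat_mats_def intro!: prod.neutral)
  finally show "A \<in> SL_mats n" using c by (simp add: SL_mats_def)
qed

lemma group_SL: "group (mat_grp n (SL_mats n :: 'k::field mat set))" (is "group ?G")
proof (rule groupI)
  fix A assume A: "A \<in> carrier ?G"
  then have c: "A \<in> carrier_mat n n" and d: "det A = 1" by (auto simp: mat_grp_def SL_mats_def)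
  then have "A \<in> Units (ring_mat TYPE('k) n undefined)" by (intro det_non_zero_imp_unit) auto
  then obtain B where B: "B \<in> carrier_mat n n" "B * A = 1\<^sub>m n"
    by (auto simp: Units_def ring_mat_def)
  then have "det B = 1" using det_mult[OF B(1) c] d by simp
  with B show "\<exists>B\<in>carrier ?G. B \<otimes>\<^bsub>?G\<^esub> A = \<one>\<^bsub>?G\<^esub>"
    by (auto simp: mat_grp_def SL_mats_def)
qed (auto simp: mat_grp_def SL_mats_def det_mult)

lemma finite_SL: "finite (SL_mats n :: 'k::{comm_ring_1,finite} mat set)"
  by (rule finite_subset[OF _ finite_carrier_mat]) (auto simp: SL_mats_def)

lemma subgroup_pat_mats:
  assumes "trans T" "\<And>i j. (i,j) \<in> T \<Longrightarrow> i < j"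
  shows "subgroup (pat_mats n T) (mat_grp n (SL_mats n :: 'k::{field,finite} mat set))"
proof -
  interpret group "mat_grp n (SL_mats n :: 'k mat set)" by (rule group_SL)
  note sub = pat_mats_subset_SL[where n = n and ?'a = 'k, OF assms(2)]
  show ?thesis
    using sub finite_subset[OF sub finite_SL] pat_mats_mult[OF assms] one_mat_pat_mats
    by (intro subgroup_of_finite_closed) (simp_all add: mat_grp_def)
qed

lemma stair_less: "a \<le> b \<Longrightarrow> (i,j) \<in> stair b a \<Longrightarrow> i < j"
  by (auto simp: stair_def)

lemma trans_stair: "a \<le> b \<Longrightarrow> trans (stair b a)"
  by (auto simp: stair_def trans_def)

section \<open>The derived subgroup of the unitriangular group\<close>

lemma unitri_eq_pat: "unitri_mats n = pat_mats n {(i,j). i < j}"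
proof -
  have "(i::nat) \<noteq> j \<and> \<not> i < j \<longleftrightarrow> j < i" for i j by auto
  moreover have "j < n" if "j < i" "i < n" for i j :: nat using that by simp
  ultimately show ?thesis unfolding unitri_mats_def pat_mats_def by (auto simp: imp_conjL)
qed

text \<open>Only k = i and k = i + 1 contribute to the sum. Each superdiagonal entry is therefore a
  homomorphism to the additive group of the ring, and so will vanish on commutators.\<close>

lemma superdiagonal_mult:
  assumes A: "A \<in> pat_mats n {(i,j). i < j}" and B: "B \<in> pat_mats n {(i,j). i < j}"
    and i: "Suc i < n"
  shows "(A * B) $$ (i, Suc i) = A $$ (i, Suc i) + B $$ (i, Suc i)"
proof -
  have c: "A \<in> carrier_mat n n" "B \<in> carrier_mat n n" using A B by (auto simp: pat_mats_def)
  have "(A * B) $$ (i, Suc i) = (\<Sum>k<n. A $$ (i,k) * B $$ (k, Suc i))"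
    using c i by (intro mult_mat_entry) auto
  also have "\<dots> = (\<Sum>k\<in>{i, Suc i}. A $$ (i,k) * B $$ (k, Suc i))"
  proof (rule sum.mono_neutral_right)
    show "\<forall>k\<in>{..<n} - {i, Suc i}. A $$ (i,k) * B $$ (k, Suc i) = 0"
    proof
      fix k assume k: "k \<in> {..<n} - {i, Suc i}"
      then consider "k < i" | "Suc i < k" by force
      then show "A $$ (i,k) * B $$ (k, Suc i) = 0"
        using A B i k by cases (auto simp: pat_mats_def)
    qed
  qed (use i in auto)
  also have "\<dots> = A $$ (i, Suc i) + B $$ (i, Suc i)"
    using A B i by (simp add: pat_mats_def)
  finally show ?thesis .
qed

text \<open>Moves the commutators from the unitriangular group to the ambient special linear group,
  in which all subgroups here are compared.\<close>

lemma DU_eq_derived: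
  "DU n = derived (mat_grp n (SL_mats n :: 'k::{field,finite} mat set)) (unitri_mats n)"
proof -
  interpret group "mat_grp n (SL_mats n :: 'k mat set)" by (rule group_SL)
  have "subgroup (unitri_mats n) (mat_grp n (SL_mats n :: 'k mat set))"
    unfolding unitri_eq_pat by (rule subgroup_pat_mats) (auto simp: trans_def)
  from derived_consistent[OF subset_refl this] show ?thesis
    by (simp add: DU_def mat_grp_def)
qed

lemma DU_subset: "DU n \<subseteq> (pat_mats n (stair 0 0) :: 'k::{field,finite} mat set)"
proof -
  let ?G = "mat_grp n (SL_mats n :: 'k mat set)"
  let ?U = "pat_mats n {(i,j). i < j} :: 'k mat set"
  interpret group ?G by (rule group_SL)
  interpret U: subgroup ?U ?G by (rule subgroup_pat_mats) (auto simp: trans_def)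
  have mult: "x \<otimes>\<^bsub>?G\<^esub> y = x * y" and one: "\<one>\<^bsub>?G\<^esub> = 1\<^sub>m n" for x y
    by (simp_all add: mat_grp_def)
  have inv: "(inv\<^bsub>?G\<^esub> A) $$ (i, Suc i) = - A $$ (i, Suc i)" if "A \<in> ?U" "Suc i < n" for A i
  proof -
    have "A $$ (i, Suc i) + (inv\<^bsub>?G\<^esub> A) $$ (i, Suc i) = (A \<otimes>\<^bsub>?G\<^esub> inv\<^bsub>?G\<^esub> A) $$ (i, Suc i)"
      unfolding mult using that by (intro superdiagonal_mult[symmetric]) auto
    also have "\<dots> = 0" using that U.subset by (subst r_inv) (auto simp: one)
    finally show ?thesis by (simp add: eq_neg_iff_add_eq_0 add.commute)
  qed
  \<comment> \<open>\<open>stair 0 0\<close> cuts out the common kernel of the superdiagonal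
    homomorphisms.\<close>
  have stair_iff: "A \<in> pat_mats n (stair 0 0) \<longleftrightarrow> A \<in> ?U \<and> (\<forall>i. Suc i < n \<longrightarrow> A $$ (i, Suc i) = 0)"
    for A
  proof (safe)
    fix A :: "'k mat" and i
    assume A: "A \<in> ?U" "\<forall>i. Suc i < n \<longrightarrow> A $$ (i, Suc i) = 0"
    have "A $$ (i,j) = 0" if "i < n" "j < n" "i \<noteq> j" "(i,j) \<notin> stair 0 0" for i j
    proof -
      from that have "j < i \<or> j = Suc i" by (auto simp: stair_def)
      then show ?thesis using A that by (auto simp: pat_mats_def)
    qed
    with A(1) show "A \<in> pat_mats n (stair 0 0)"
      by (simp add: pat_mats_def)
  qed (auto simp: pat_mats_def stair_def split: if_splits)
  have "derived_set ?G ?U \<subseteq> pat_mats n (stair 0 0)"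
  proof (safe)
    fix A B assume AB: "A \<in> ?U" "B \<in> ?U"
    let ?C = "A \<otimes>\<^bsub>?G\<^esub> B \<otimes>\<^bsub>?G\<^esub> inv\<^bsub>?G\<^esub> A \<otimes>\<^bsub>?G\<^esub> inv\<^bsub>?G\<^esub> B"
    have U: "?C \<in> ?U" "A \<otimes>\<^bsub>?G\<^esub> B \<otimes>\<^bsub>?G\<^esub> inv\<^bsub>?G\<^esub> A \<in> ?U" "A \<otimes>\<^bsub>?G\<^esub> B \<in> ?U" using AB by blast+
    have "?C $$ (i, Suc i) = 0" if "Suc i < n" for i
      using U AB that unfolding mult by (simp add: superdiagonal_mult inv)
    with U show "?C \<in> pat_mats n (stair 0 0)" by (simp add: stair_iff)
  qed
  moreover have "subgroup (pat_mats n (stair 0 0)) ?G"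
    by (intro subgroup_pat_mats trans_stair) (auto dest: stair_less[OF order_refl])
  ultimately show ?thesis
    unfolding DU_eq_derived derived_def unitri_eq_pat by (intro generate_subgroup_incl)
qed

section \<open>Conjugation by shears\<close>

lemma shear_conj_entry:
  fixes x :: "'k::comm_ring_1 mat"
  assumes x: "x \<in> carrier_mat n n" and kl: "k < n" "l < n" and ij: "i < n" "j < n"
  shows "(addrow_mat n c k l * x * addrow_mat n (- c) k l) $$ (i,j)
    = (let z = \<lambda>i j. x $$ (i,j) + (if i = k then c * x $$ (l,j) else 0)
       in z i j - (if j = l then c * z i k else 0))"
proof -
  \<comment> \<open>The left factor adds c times row l to row k; the right factor, its inverse when
    k and l differ, subtracts c times column k from column l.\<close>
  have "addrow_mat n c k l * x * addrow_mat n (- c) k l = addcol (- c) l k (addrow c k l x)"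
    unfolding addrow_mat[OF x kl(2), symmetric] using x by (intro addcol_mat[OF _ kl(1), symmetric]) simp
  then show ?thesis using x kl ij by (auto simp: Let_def algebra_simps)
qed


lemma shear_in_SL:
  "k \<noteq> l \<Longrightarrow> addrow_mat n c k l \<in> SL_mats n"
  by (simp add: SL_mats_def det_addrow_mat)

text \<open>The matrices in \<open>pat_mats n (stair b (a + 2))\<close> agree with the identity in the columns
  \<open>a\<close> and \<open>a + 1\<close>, so a shear in these two coordinates acts on them by row operations only.\<close>

lemma shear_conj_stair:
  fixes c :: "'k::comm_ring_1"
  assumes x: "x \<in> pat_mats n (stair b (a + 2))" and ab: "a + 2 \<le> b" "b < n"
    and kl: "k \<in> {a, a + 1}" "l \<in> {a, a + 1}" "k \<noteq> l"
  defines "y \<equiv> addrow_mat n c k l * x * addrow_mat n (- c) k l"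
  shows "y \<in> pat_mats n (stair b (a + 2))"
    and "y $$ (k,b) = x $$ (k,b) + c * x $$ (l,b)" and "y $$ (l,b) = x $$ (l,b)"
proof -
  have xc: "x \<in> carrier_mat n n" and d: "\<And>i. i < n \<Longrightarrow> x $$ (i,i) = 1"
    and z: "\<And>i j. i < n \<Longrightarrow> j < n \<Longrightarrow> i \<noteq> j \<Longrightarrow> (i,j) \<notin> stair b (a + 2) \<Longrightarrow> x $$ (i,j) = 0"
    using x by (auto simp: pat_mats_def)
  have kn: "k < n" "l < n" "k < b" "l < b" using kl ab by auto
  \<comment> \<open>Left of column b, x looks like the identity: the row operation creates a single
    entry c at (k,l), and the column operation removes it again.\<close>
  have entry: "y $$ (i,j) = (if j < b then (if i = j then 1 else 0)
      else x $$ (i,j) + (if i = k then c * x $$ (l,j) else 0))" if "i < n" "j < n" for i j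
  proof -
    have col: "x $$ (i,j) = (if i = j then 1 else 0)" if "i < n" "j < b" for i j
      using z[of i j] d that ab by (auto simp: stair_def)
    show ?thesis
      unfolding y_def shear_conj_entry[OF xc kn(1,2) that] Let_def
      using that kn kl(3) col by auto
  qed
  show "y $$ (k,b) = x $$ (k,b) + c * x $$ (l,b)" "y $$ (l,b) = x $$ (l,b)"
    using entry kn ab kl(3) by simp_all
  have "y \<in> carrier_mat n n" unfolding y_def using xc by (intro mult_carrier_mat[of _ n n]) simp_all
  moreover have "y $$ (i,i) = 1" if "i < n" for i
    using entry[OF that that] d that kn by (auto intro!: z simp: stair_def)
  moreover have "y $$ (i,j) = 0" if "i < n" "j < n" "i \<noteq> j" "(i,j) \<notin> stair b (a + 2)" for i j
  proof (cases "j < b")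
    case False
    \<comment> \<open>Vacuous: since a + 2 \<le> b, row k is free in every column from b on.\<close>
    have "i = k \<Longrightarrow> l \<noteq> j \<and> (l,j) \<notin> stair b (a + 2)"
      using that False kl ab by (auto simp: stair_def)
    then show ?thesis using entry[of i j] that z kn False by simp
  qed (use entry that in simp)
  ultimately show "y \<in> pat_mats n (stair b (a + 2))" by (simp add: pat_mats_def)
qed

text \<open>Conjugation by the shear preserves the pattern group and shears its coordinates in rows
  k and l of column b. Pulling an indicator back along it is a two-sided translation;
  \<open>Q\<close> will be the equation of a line.\<close>

lemma shear_conj_in_bispan:
  fixes Q :: "'k::{field,finite} \<Rightarrow> 'k \<Rightarrow> bool"
  assumes ab: "a + 2 \<le> b" "b < n" and kl: "k \<in> {a, a + 1}" "l \<in> {a, a + 1}" "k \<noteq> l"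
  shows "(\<lambda>x. of_bool (x \<in> pat_mats n (stair b (a + 2)) \<and> Q (x $$ (k,b) + c * x $$ (l,b)) (x $$ (l,b))) :: 'r)
    \<in> bispan (mat_grp n (SL_mats n)) (\<lambda>x. of_bool (x \<in> pat_mats n (stair b (a + 2)) \<and> Q (x $$ (k,b)) (x $$ (l,b))) :: 'r::comm_ring_1)"
    (is "?f \<in> bispan ?G ?e")
proof -
  let ?g = "addrow_mat n c k l" and ?h = "addrow_mat n (- c) k l"
  let ?P = "pat_mats n (stair b (a + 2)) :: 'k mat set"
  have kn: "k < n" "l < n" using kl ab by auto
  have gh: "?g * ?h = 1\<^sub>m n" "?h * ?g = 1\<^sub>m n"
    using addrow_mat_inv[OF kn kl(3), of c] addrow_mat_inv[OF kn kl(3), of "- c"] by simp_all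
  have "(\<lambda>x. if x \<in> carrier ?G then ?e (?g \<otimes>\<^bsub>?G\<^esub> x \<otimes>\<^bsub>?G\<^esub> ?h) else 0) \<in> bispan ?G ?e"
    using shear_in_SL[OF kl(3)] by (intro bispan.translate bispan.base) (simp_all add: mat_grp_def)
  also have "(\<lambda>x. if x \<in> carrier ?G then ?e (?g \<otimes>\<^bsub>?G\<^esub> x \<otimes>\<^bsub>?G\<^esub> ?h) else 0) = ?f"
  proof
    fix x :: "'k mat"
    have PG: "?P \<subseteq> carrier ?G"
      using pat_mats_subset_SL[of "stair b (a + 2)" n] stair_less[OF ab(1)] by (auto simp: mat_grp_def)
    show "(if x \<in> carrier ?G then ?e (?g \<otimes>\<^bsub>?G\<^esub> x \<otimes>\<^bsub>?G\<^esub> ?h) else 0) = ?f x"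
    proof (cases "x \<in> ?P")
      case True
      then show ?thesis
        using shear_conj_stair[OF True ab kl, of c] PG by (auto simp: mat_grp_def)
    next
      case False
      \<comment> \<open>Were the conjugate in the pattern group, conjugating back by the inverse
        shear would put x there too.\<close>
      have "?g * x * ?h \<notin> ?P" if x: "x \<in> carrier ?G"
      proof
        have xc: "x \<in> carrier_mat n n" using x by (simp add: mat_grp_def SL_mats_def)
        assume "?g * x * ?h \<in> ?P"
        from shear_conj_stair(1)[OF this ab kl, of "- c"]
        have "?h * (?g * x * ?h) * ?g \<in> ?P" by simp
        also have "?h * (?g * x * ?h) * ?g = ?h * (?g * x * (?h * ?g))"
          using xc by (simp add: assoc_mult_mat[of _ n n _ n _ n] mult_carrier_mat[of _ n n])
        also have "\<dots> = ?h * (?g * x)" using xc by (simp add: gh mult_carrier_mat[of _ n n])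
        also have "\<dots> = x" using xc assoc_mult_mat[of ?h n n ?g n x n] by (simp add: gh)
        finally show False using False by simp
      qed
      then show ?thesis using False by (auto simp: mat_grp_def)
    qed
  qed
  finally show ?thesis .
qed

section \<open>Removing root positions one at a time\<close>

lemma pat_mats_insert:
  assumes "(k,l) \<notin> T" "k \<noteq> l" "k < n" "l < n"
  shows "x \<in> pat_mats n T \<longleftrightarrow> x \<in> pat_mats n (insert (k,l) T) \<and> x $$ (k,l) = 0"
proof (intro iffI conjI)
  assume x: "x \<in> pat_mats n T"
  then show "x \<in> pat_mats n (insert (k,l) T)" using pat_mats_mono[of T "insert (k,l) T"] by blast
  show "x $$ (k,l) = 0" using x assms by (simp add: pat_mats_def)
next
  assume x: "x \<in> pat_mats n (insert (k,l) T) \<and> x $$ (k,l) = 0"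
  have "x $$ (i,j) = 0" if "i < n" "j < n" "i \<noteq> j" "(i,j) \<notin> T" for i j
    using x that by (cases "(i,j) = (k,l)") (auto simp: pat_mats_def)
  then show "x \<in> pat_mats n T" using x by (simp add: pat_mats_def)
qed

text \<open>Equations, in the two plane coordinates, of the line that one starts from and of the
  origin that one wants to reach.\<close>

lemma stair_Suc_iff:
  assumes "a + 2 \<le> b" "b < n"
  shows "x \<in> pat_mats n (stair b (a + 1)) \<longleftrightarrow> x \<in> pat_mats n (stair b (a + 2)) \<and> x $$ (a + 1, b) = 0"
    and "x \<in> pat_mats n (stair b a)
      \<longleftrightarrow> x \<in> pat_mats n (stair b (a + 2)) \<and> x $$ (a, b) = 0 \<and> x $$ (a + 1, b) = 0"
proof -
  have step: "x \<in> pat_mats n (stair b c) \<longleftrightarrow> x \<in> pat_mats n (stair b (c + 1)) \<and> x $$ (c, b) = 0"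
    if "c < b" for c
  proof -
    have "stair b (c + 1) = insert (c, b) (stair b c)" "(c, b) \<notin> stair b c"
      by (auto simp: stair_def)
    then show ?thesis using that assms(2) pat_mats_insert[of c b "stair b c" n x] by simp
  qed
  show *: "x \<in> pat_mats n (stair b (a + 1)) \<longleftrightarrow> x \<in> pat_mats n (stair b (a + 2)) \<and> x $$ (a + 1, b) = 0"
    using step[of "a + 1"] assms(1) by simp
  show "x \<in> pat_mats n (stair b a)
      \<longleftrightarrow> x \<in> pat_mats n (stair b (a + 2)) \<and> x $$ (a, b) = 0 \<and> x $$ (a + 1, b) = 0"
    using step[of a] * assms(1) by auto
qed

text \<open>In column b + 1 the rows above b are exactly those above the superdiagonal, so a cleared
  column b is the starting point for the next column.\<close>

lemma stair_Suc_0: "stair (Suc b) b = stair b 0"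
  by (auto simp: stair_def)

lemma stair_step:
  fixes y :: "'r::comm_ring_1"
  assumes ab: "a + 2 \<le> b" "b < n" and y: "of_nat (card (UNIV :: 'k::{field,finite} set)) * y = 1"
  shows "(\<lambda>x. of_bool (x \<in> pat_mats n (stair b a)) :: 'r)
    \<in> bispan (mat_grp n (SL_mats n :: 'k mat set)) (\<lambda>x. of_bool (x \<in> pat_mats n (stair b (a + 1))))"
    (is "_ \<in> bispan ?G ?e")
proof -
  interpret group ?G by (rule group_SL)
  let ?P = "pat_mats n (stair b (a + 2)) :: 'k mat set"
  \<comment> \<open>This \<open>?H\<close> is the preimage of the line where the coordinate in row a
    + 1 vanishes; the smaller group to be reached is \<open>pat_mats n (stair b a)\<close>.\<close>
  let ?H = "pat_mats n (stair b (a + 1)) :: 'k mat set"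
  have less: "\<And>i j. (i,j) \<in> stair b (a + 1) \<Longrightarrow> i < j" using ab stair_less[of "a + 1" b] by simp
  obtain N where "card ?H = card (UNIV :: 'k set) ^ N" using card_pat_mats[OF less] by blast
  then have "of_nat (card ?H) * y ^ N = 1" by (simp flip: power_mult_distrib add: y)
  moreover have "subgroup ?P ?G"
    using ab by (intro subgroup_pat_mats trans_stair) (auto intro: stair_less)
  moreover have "finite ?P" by (rule finite_subset[OF _ finite_carrier_mat]) (auto simp: pat_mats_def)
  moreover have "?H \<subseteq> ?P" by (intro pat_mats_mono) (auto simp: stair_def)
  ultimately have P: "(\<lambda>x. of_bool (x \<in> ?P)) \<in> bispan ?G ?e"
    by (intro supergroup_in_bispan)
  \<comment> \<open>The starting line is fixed by shears that add multiples of coordinate a + 1 to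
    coordinate a, so it is first moved to the diagonal line \<open>?M\<close>.\<close>
  let ?M = "\<lambda>x. of_bool (x \<in> ?P \<and> x $$ (a + 1, b) = x $$ (a, b)) :: 'r"
  have "?M \<in> bispan ?G ?e"
    using shear_conj_in_bispan[OF ab, of "a + 1" a "\<lambda>s t. s = 0" "- 1", where ?'r = 'r]
    unfolding stair_Suc_iff(1)[OF ab] by simp
  \<comment> \<open>With s and t the coordinates in rows a and a + 1, s + (1 - u) t = t says s = u
    t, whence the constant \<open>1 - u\<close>.\<close>
  moreover have "(\<lambda>x. of_bool (x \<in> ?P \<and> x $$ (a, b) = u * x $$ (a + 1, b))) \<in> bispan ?G ?M" for u
    using shear_conj_in_bispan[OF ab, of a "a + 1" "\<lambda>s t. t = s" "1 - u", where ?'r = 'r]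
    by (simp add: algebra_simps eq_commute)
  ultimately have L: "(\<lambda>x. of_bool (x \<in> ?P \<and> x $$ (a, b) = u * x $$ (a + 1, b))) \<in> bispan ?G ?e" for u
    by (rule bispan_trans[rotated])
  \<comment> \<open>The q lines s = u t together with the starting line t = 0 are all q + 1 lines. A
    nonzero point lies on exactly one and is cancelled by the indicator of \<open>?P\<close>; the
    origin keeps weight q, which y inverts.\<close>
  have "(\<lambda>x. y * ((\<Sum>u\<in>UNIV. of_bool (x \<in> ?P \<and> x $$ (a, b) = u * x $$ (a + 1, b))) + ?e x
      + - 1 * of_bool (x \<in> ?P))) \<in> bispan ?G ?e"
    by (intro bispan.scale bispan.add bispan_sum L P bispan.base) simp
  also have "(\<lambda>x. y * ((\<Sum>u\<in>UNIV. of_bool (x \<in> ?P \<and> x $$ (a, b) = u * x $$ (a + 1, b))) + ?e x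
      + - 1 * of_bool (x \<in> ?P))) = (\<lambda>x. of_bool (x \<in> pat_mats n (stair b a)) :: 'r)"
  proof
    fix x :: "'k mat"
    let ?s = "x $$ (a, b)" and ?t = "x $$ (a + 1, b)"
    have "(\<Sum>u\<in>UNIV. of_bool (?s = u * ?t) :: 'r)
        = (if ?t \<noteq> 0 then 1 else if ?s = 0 then of_nat (card (UNIV :: 'k set)) else 0)"
    proof (cases "?t = 0")
      case False
      then have "(\<Sum>u\<in>UNIV. of_bool (?s = u * ?t) :: 'r) = (\<Sum>u\<in>UNIV. if u = ?s / ?t then 1 else 0)"
        by (intro sum.cong) (auto simp: field_simps)
      with False show ?thesis by simp
    qed simp
    then show "y * ((\<Sum>u\<in>UNIV. of_bool (x \<in> ?P \<and> ?s = u * ?t)) + ?e x + - 1 * of_bool (x \<in> ?P))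
        = of_bool (x \<in> pat_mats n (stair b a))"
      unfolding stair_Suc_iff[OF ab] using y by (cases "x \<in> ?P") (auto simp: mult.commute)
  qed
  finally show ?thesis .
qed

text \<open>Induction on the columns, and within column b + 1 a descent of a from b to 0 by
  \<open>stair_step\<close>.\<close>

lemma stair_in_bispan:
  fixes y :: "'r::comm_ring_1" and n :: nat
  assumes y: "of_nat (card (UNIV :: 'k::{field,finite} set)) * y = 1"
  defines "e \<equiv> \<lambda>x :: 'k mat. of_bool (x \<in> pat_mats n (stair 0 0)) :: 'r"
  shows "b < n \<Longrightarrow> (\<lambda>x. of_bool (x \<in> pat_mats n (stair b 0))) \<in> bispan (mat_grp n (SL_mats n :: 'k mat set)) e"
proof (induction b)
  case 0
  show ?case unfolding e_def by (rule bispan.base)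
next
  case (Suc b)
  have "(\<lambda>x. of_bool (x \<in> pat_mats n (stair (Suc b) a))) \<in> bispan (mat_grp n (SL_mats n :: 'k mat set)) e"
    if "a \<le> b" for a
    using that
  proof (induction rule: inc_induct)
    case base
    show ?case using Suc by (simp add: stair_Suc_0)
  next
    case (step a)
    have "(\<lambda>x. of_bool (x \<in> pat_mats n (stair (Suc b) a)) :: 'r)
      \<in> bispan (mat_grp n (SL_mats n :: 'k mat set)) (\<lambda>x. of_bool (x \<in> pat_mats n (stair (Suc b) (a + 1))))"
      using step.hyps Suc.prems by (intro stair_step[OF _ _ y]) auto
    with step.IH show ?case using bispan_trans by fastforce
  qed
  then show ?case by blast
qed

section \<open>Idempotence and fullness\<close>

theorem theorem1:
  fixes n p :: nat
    and q :: "'k::{field, finite} itself"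
    and r :: "'r::comm_ring_1 itself"
  assumes "n \<ge> 1"
    and "prime p"
    and "\<exists>m. card (UNIV :: 'k set) = p ^ m"
    and "\<exists>y::'r. of_nat p * y = 1"
  shows "galg_mult (mat_grp n (SL_mats n :: 'k mat set)) (e_idem n :: 'k mat \<Rightarrow> 'r) (e_idem n) = e_idem n
       \<and> galg_two_sided (mat_grp n (SL_mats n :: 'k mat set)) (e_idem n :: 'k mat \<Rightarrow> 'r)
           = galg_carrier (mat_grp n (SL_mats n :: 'k mat set))"
proof -
  let ?G = "mat_grp n (SL_mats n :: 'k mat set)"
  let ?D = "DU n :: 'k mat set" and ?S = "pat_mats n (stair 0 0) :: 'k mat set"
  interpret group ?G by (rule group_SL)
  have finG: "finite (carrier ?G)" by (simp add: mat_grp_def finite_SL)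
  obtain m and z :: 'r where "card (UNIV :: 'k set) = p ^ m" "of_nat p * z = 1"
    using assms(3,4) by blast
  then have y: "of_nat (card (UNIV :: 'k set)) * z ^ m = 1" by (simp flip: power_mult_distrib)
  have less: "\<And>i j. (i,j) \<in> stair 0 0 \<Longrightarrow> i < j" using stair_less[of 0 0] by simp
  have S: "subgroup ?S ?G" by (intro subgroup_pat_mats trans_stair less) auto
  have U: "unitri_mats n \<subseteq> carrier ?G"
    unfolding unitri_eq_pat mat_grp_def using pat_mats_subset_SL[of "{(i,j). i < j}" n] by simp
  have D: "subgroup ?D ?G" unfolding DU_eq_derived using U by (rule derived_is_subgroup)
  interpret SG: group "?G\<lparr>carrier := ?S\<rparr>" using S by (rule subgroup_imp_group)
  \<comment> \<open>By Lagrange the order of the derived subgroup divides a power of q, hence is a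
    unit of R; its inverse is the cofactor times the inverse of that power.\<close>
  have "subgroup ?D (?G\<lparr>carrier := ?S\<rparr>)"
    by (rule subgroup_incl[OF D S DU_subset])
  from SG.lagrange[OF this] have "card ?D dvd order (?G\<lparr>carrier := ?S\<rparr>)"
    by (metis dvd_triv_right)
  then have dvd: "card ?D dvd card ?S" by (simp add: order_def)
  obtain w where w: "of_nat (card ?D) * (w :: 'r) = 1"
  proof -
    assume that: "\<And>w. of_nat (card ?D) * (w :: 'r) = 1 \<Longrightarrow> thesis"
    obtain N where N: "card ?S = card (UNIV :: 'k set) ^ N" using card_pat_mats[OF less] by blast
    obtain d where "card ?S = card ?D * d" using dvd by blast
    then have "of_nat (card ?D) * (of_nat d * (z ^ m) ^ N) = (of_nat (card ?S) * (z ^ m) ^ N :: 'r)"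
      by (simp add: mult.assoc)
    also have "\<dots> = 1" unfolding N by (simp add: y flip: power_mult_distrib)
    finally show thesis by (rule that)
  qed
  \<comment> \<open>Inverses are unique, so the definite description in \<open>e_idem\<close>
    denotes \<open>w\<close>.\<close>
  have the: "(THE y. of_nat (card ?D) * (y :: 'r) = 1) = w"
  proof (rule the_equality)
    fix v :: 'r assume v: "of_nat (card ?D) * v = 1"
    have "v = of_nat (card ?D) * w * v" by (simp add: w)
    also have "\<dots> = of_nat (card ?D) * v * w" by (simp add: ac_simps)
    finally show "v = w" by (simp add: v)
  qed (fact w)
  have e: "(e_idem n :: 'k mat \<Rightarrow> 'r) = (\<lambda>g. if g \<in> ?D then w else 0)"
    unfolding e_idem_def the ..
  have "galg_mult ?G (e_idem n :: 'k mat \<Rightarrow> 'r) (e_idem n) = e_idem n"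
    unfolding e by (rule idempotent_subgroup[OF finG D w])
  moreover have "galg_two_sided ?G (e_idem n :: 'k mat \<Rightarrow> 'r) = galg_carrier ?G"
  proof (rule two_sided_eq_carrier[OF finG])
    show "(e_idem n :: 'k mat \<Rightarrow> 'r) \<in> galg_carrier ?G"
      using subgroup.subset[OF D] by (auto simp: e galg_carrier_def)
    \<comment> \<open>Column n - 1 is the last one, so once it is cleared no position inside the
      matrix is free.\<close>
    have one: "(\<lambda>x. of_bool (x \<in> {\<one>\<^bsub>?G\<^esub>}) :: 'r) = (\<lambda>x. of_bool (x \<in> pat_mats n (stair (n - 1) 0)))"
    proof -
      have "pat_mats n (stair (n - 1) 0) = (pat_mats n {} :: 'k mat set)"
        by (rule pat_mats_cong) (auto simp: stair_def)
      then show ?thesis by (simp add: pat_mats_empty mat_grp_def)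
    qed
    have "(\<lambda>x. of_bool (x \<in> pat_mats n (stair (n - 1) 0)) :: 'r) \<in> bispan ?G (\<lambda>x. of_bool (x \<in> ?S))"
      using assms(1) by (intro stair_in_bispan[OF y]) simp
    moreover have "(\<lambda>x. of_bool (x \<in> ?S)) \<in> bispan ?G (\<lambda>x. of_bool (x \<in> ?D) :: 'r)"
      using S DU_subset w finite_subset[OF subgroup.subset[OF S] finG]
      by (intro supergroup_in_bispan)
    \<comment> \<open>Multiplying by the order of the derived subgroup undoes the normalisation of
      \<open>e_idem\<close>.\<close>
    moreover have "(\<lambda>x. of_bool (x \<in> ?D)) \<in> bispan ?G (e_idem n :: 'k mat \<Rightarrow> 'r)"
    proof -
      have "(\<lambda>x. of_nat (card ?D) * e_idem n x) \<in> bispan ?G (e_idem n :: 'k mat \<Rightarrow> 'r)"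
        by (intro bispan.scale bispan.base)
      also have "(\<lambda>x. of_nat (card ?D) * e_idem n x) = (\<lambda>x. of_bool (x \<in> ?D) :: 'r)"
        by (auto simp: e w)
      finally show ?thesis .
    qed
    ultimately show "(\<lambda>x. of_bool (x \<in> {\<one>\<^bsub>?G\<^esub>})) \<in> bispan ?G (e_idem n :: 'k mat \<Rightarrow> 'r)"
      unfolding one by (rule bispan_trans[OF bispan_trans])
  qed
  ultimately show ?thesis by simp
qed

end
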